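(* (a) For $n\ge 2$, the Minkowski sum $\sum_{\mathbf{S}}\Delta_{\mathbf{S}}$ over all coarsenings $\mathbf{S}$ of the cyclic order $(1,2,\dots,n)$ having at most one block with more than one element (the alcoved realization of the cyclohedron $C_n$) is alcoved. (b) The Minkowski sum $\sum_{\mathbf{S}}\Delta_{\mathbf{S}}$ over all coarsenings $\mathbf{S}$ of $(1,2,\dots,n)$ having at most one block with more than one element and such that $n$ lies in that block whenever it exists (the alcoved realization of the associahedron $A_n$) is alcoved. (c) For $n\ge 3$, the $\hat{D}_n$-polytope $\hat{D}_n=\sum_{s,t\in[n-1]}\Delta_{\hat{\mathbf{S}}_{s,t}}$ is alcoved.
   Context: $\mathcal{H}_n=\{x\in\mathbb{R}^n:\sum x_i=0\}$; a polytope in $\mathcal{H}_n$ is alcoved if all its facet normal directions are parallel to roots $e_i-e_j$. For an ordered set partition $\mathbf{S}=(B_1,\dots,B_\ell)$ of $[n]$ (nonempty disjoint blocks covering $[n]$, considered up to cyclic shift of blocks), $\Delta_{\mathbf{S}}\subseteq\mathcal{H}_n$ is defined by $x_i=x_j$ for $i,j$ in a common block, $x_i\ge x_j$ for $i\in B_k,j\in B_{k+1}$ ($1\le k\le\ell-1$), and $x_i\ge x_j-1$ for $i\in B_\ell,j\in B_1$. A coarsening of the cyclic order $(1,2,\dots,n)$ is an ordered set partition obtained by grouping cyclically consecutive elements of $1,2,\dots,n$ into blocks, keeping the cyclic order. The cyclohedron $C_n=\sum_I\Delta_I$ (sum over cyclic intervals $I\subseteq[n]$, $\Delta_I=\mathrm{conv}\{e_i:i\in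 I\}$) and associahedron $A_n$ (sum over linear intervals) are, via the linear map $e_i\mapsto\sum_{j<i}e_j$ and the identification of $N_{\mathbf{S}}$ with $\Delta_{\mathbf{S}}$, normally equivalent to the sums in (a) and (b), which is the sense in which the paper says $A_n$ and $C_n$ are alcoved. For a cyclic interval $[s,t]\subseteq[n-1]$ (indices modulo $n-1$), $\hat{\mathbf{S}}_{s,t}$ is the ordered set partition of $[n]$ given by $([s,t]\cup\{n\},t+1,t+2,\dots,s-1)$, i.e. the first block is $[s,t]\cup\{n\}$ followed by singletons of the remaining elements of $[n-1]$ in cyclic order. *)

theory Defs
  imports "HOL-Analysis.Analysis"
begin

text \<open>
  Coordinates of \<^typ>\<open>real ^ 'n\<close> are labelled by \<open>{1..n}\<close>, \<open>n = CARD('n)\<close>, through a bijection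
  \<open>e\<close>; the combinatorics takes place on \<open>{1..n}\<close>. Minkowski sums are the library's addition of
  sets, so \<open>\<Sum>S\<in>R. P S\<close> is an iterated Minkowski sum (for finite \<open>R\<close>).
\<close>

definition sum_zero_space :: "(real ^ 'n) set" where
  "sum_zero_space = {x. (\<Sum>i\<in>UNIV. x $ i) = 0}"

definition type_A_root :: "'n \<Rightarrow> 'n \<Rightarrow> real ^ 'n" where
  "type_A_root i j = axis i 1 - axis j 1"

definition facet_normal :: "(real ^ 'n) set \<Rightarrow> (real ^ 'n) set \<Rightarrow> real ^ 'n \<Rightarrow> bool" where
  "facet_normal P F v \<longleftrightarrow> F facet_of P \<and> v \<in> sum_zero_space \<and> v \<noteq> 0 \<and>
     (\<exists>b. P \<subseteq> {x. v \<bullet> x \<le> b} \<and> F = P \<inter> {x. v \<bullet> x = b})"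

text \<open>
  If \<open>P\<close> has dimension \<open>n - 1\<close>, the normal of a facet is unique up to a positive factor. If \<open>P\<close>
  has smaller positive dimension, all supporting normals in the hyperplane are required to be
  parallel to roots, which never holds; so \<open>alcoved\<close> is the full-dimensional notion, apart from
  polytopes with at most one point.
\<close>

definition alcoved :: "(real ^ 'n) set \<Rightarrow> bool" where
  "alcoved P \<longleftrightarrow> polytope P \<and> P \<subseteq> sum_zero_space \<and>
     (\<forall>F v. facet_normal P F v \<longrightarrow> (\<exists>i j c. i \<noteq> j \<and> v = c *\<^sub>R type_A_root i j))"

definition ordered_set_partition :: "nat \<Rightarrow> nat set list \<Rightarrow> bool" where
  "ordered_set_partition n S \<longleftrightarrow> {} \<notin> set S \<and> \<Union> (set S) = {1..n} \<and>
     (\<forall>k < length S. \<forall>l < length S. k \<noteq> l \<longrightarrow> S ! k \<inter> S ! l = {})"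

definition Delta :: "(nat \<Rightarrow> 'n) \<Rightarrow> nat set list \<Rightarrow> (real ^ 'n) set" where
  "Delta e S = {x \<in> sum_zero_space.
     (\<forall>B \<in> set S. \<forall>i \<in> B. \<forall>j \<in> B. x $ e i = x $ e j) \<and>
     (\<forall>k. Suc k < length S \<longrightarrow> (\<forall>i \<in> S ! k. \<forall>j \<in> S ! Suc k. x $ e i \<ge> x $ e j)) \<and>
     (\<forall>i \<in> last S. \<forall>j \<in> hd S. x $ e i \<ge> x $ e j - 1)}"

text \<open>
  The cyclic word \<open>1, \<dots>, n\<close> is read from any starting point and cut into nonempty consecutive
  pieces. The resulting set is closed under cyclic shifts of the blocks.
\<close>

definition cyclic_coarsenings :: "nat \<Rightarrow> nat set list set" where
  "cyclic_coarsenings n =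
     {map set xss |xss k. [] \<notin> set xss \<and> concat xss = rotate k [1..<Suc n]}"

definition one_big_coarsenings :: "nat \<Rightarrow> nat set list set" where
  "one_big_coarsenings n =
     {S \<in> cyclic_coarsenings n. length (filter (\<lambda>B. card B > 1) S) \<le> 1}"

definition one_big_coarsenings_last :: "nat \<Rightarrow> nat set list set" where
  "one_big_coarsenings_last n =
     {S \<in> one_big_coarsenings n. \<forall>B \<in> set S. card B > 1 \<longrightarrow> n \<in> B}"

text \<open>
  Ordered set partitions are taken up to cyclic shift of the blocks, and a shift translates
  \<open>Delta e S\<close>. A sum over classes is taken over a set \<open>R\<close> containing exactly one representative of
  every class; it depends on \<open>R\<close> only up to translation.
\<close>

definition shift_representatives :: "'a list set \<Rightarrow> 'a list set \<Rightarrow> bool" where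
  "shift_representatives C R \<longleftrightarrow> R \<subseteq> C \<and> (\<forall>S \<in> C. \<exists>!T. T \<in> R \<and> (\<exists>k. T = rotate k S))"

text \<open>
  The interval \<open>[s,t]\<close> of \<open>{1..m}\<close> read modulo \<open>m\<close>, and the list \<open>t+1, \<dots>, s-1\<close> of the remaining
  elements; for \<open>s = t + 1\<close> the interval is all of \<open>{1..m}\<close>.
\<close>

definition cyclic_interval :: "nat \<Rightarrow> nat \<Rightarrow> nat \<Rightarrow> nat set" where
  "cyclic_interval m s t = (if s \<le> t then {s..t} else {s..m} \<union> {1..t})"

definition cyclic_rest :: "nat \<Rightarrow> nat \<Rightarrow> nat \<Rightarrow> nat list" where
  "cyclic_rest m s t = (if s \<le> t then [Suc t..<Suc m] @ [1..<s] else [Suc t..<s])"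

definition S_hat :: "nat \<Rightarrow> nat \<Rightarrow> nat \<Rightarrow> nat set list" where
  "S_hat n s t = (cyclic_interval (n - 1) s t \<union> {n}) # map (\<lambda>i. {i}) (cyclic_rest (n - 1) s t)"

definition D_hat :: "(nat \<Rightarrow> 'n) \<Rightarrow> nat \<Rightarrow> (real ^ 'n) set" where
  "D_hat e n = (\<Sum>(s, t) \<in> {1..n - 1} \<times> {1..n - 1}. Delta e (S_hat n s t))"

lemma ordered_set_partition_map_set:
  assumes "distinct (concat xss)" "[] \<notin> set xss" "set (concat xss) = {1..n}"
  shows "ordered_set_partition n (map set xss)"
proof -
  have "set (xss ! k) \<inter> set (xss ! l) = {}"
    if "k < length xss" "l < length xss" "k \<noteq> l" for k l
  proof -
    have "distinct (xss ! i)" if "i < length xss" for i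
      using assms(1) that by (auto simp: distinct_concat_iff)
    moreover have "xss ! k \<noteq> xss ! l"
    proof
      assume eq: "xss ! k = xss ! l"
      have "distinct (removeAll [] xss)"
        using assms(1) by (simp add: distinct_concat_iff)
      then have "distinct xss"
        using assms(2) by (simp add: removeAll_id)
      with eq that show False by (simp add: nth_eq_iff_index_eq)
    qed
    ultimately show ?thesis
      using assms(1) that by (auto simp: distinct_concat_iff)
  qed
  with assms(2,3) show ?thesis
    by (auto simp: ordered_set_partition_def)
qed

lemma ordered_set_partition_cyclic_coarsening:
  assumes "S \<in> cyclic_coarsenings n"
  shows "ordered_set_partition n S"
proof -
  from assms obtain xss k where S: "S = map set xss" and ne: "[] \<notin> set xss"
    and c: "concat xss = rotate k [1..<Suc n]"
    by (auto simp: cyclic_coarsenings_def)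
  have "set (concat xss) = {1..n}" "distinct (concat xss)"
    unfolding c by auto
  with ne S show ?thesis by (metis ordered_set_partition_map_set)
qed

lemma ordered_set_partition_S_hat:
  assumes "s \<in> {1..n - 1}" "t \<in> {1..n - 1}"
  shows "ordered_set_partition n (S_hat n s t)"
proof -
  let ?I = "sorted_list_of_set (cyclic_interval (n - 1) s t) @ [n]"
  let ?xss = "?I # map (\<lambda>i. [i]) (cyclic_rest (n - 1) s t)"
  have fin: "finite (cyclic_interval (n - 1) s t)"
    by (simp add: cyclic_interval_def)
  have conc: "concat (map (\<lambda>i. [i]) ys) = ys" for ys :: "nat list"
    by (induction ys) auto
  have "S_hat n s t = map set ?xss"
    using fin by (simp add: S_hat_def comp_def)
  moreover have "distinct (concat ?xss)"
    using assms fin by (auto simp: conc cyclic_interval_def cyclic_rest_def)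
  moreover have "set (concat ?xss) = {1..n}"
    using assms fin by (auto simp: conc cyclic_interval_def cyclic_rest_def)
  moreover have "[] \<notin> set ?xss" by auto
  ultimately show ?thesis by (metis ordered_set_partition_map_set)
qed

lemma finite_cyclic_coarsenings: "finite (cyclic_coarsenings n)"
proof -
  have "length S \<le> n \<and> set S \<subseteq> Pow {1..n}" if S: "S \<in> cyclic_coarsenings n" for S
  proof -
    have le: "length xss \<le> length (concat xss)" if "[] \<notin> set xss" for xss :: "nat list list"
      using that
    proof (induction xss)
      case (Cons xs xss)
      then have "Suc 0 \<le> length xs" by (cases xs) auto
      moreover have "length xss \<le> length (concat xss)" using Cons by simp
      ultimately have "Suc (length xss) \<le> length xs + length (concat xss)" by linarith
      then show ?case by simp
    qed simp
    from S obtain xss k where "S = map set xss" "[] \<notin> set xss"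
      "concat xss = rotate k [1..<Suc n]"
      by (auto simp: cyclic_coarsenings_def)
    with le[of xss] have "length S \<le> n" by (simp del: upt_Suc)
    moreover have "\<Union> (set S) = {1..n}"
      using ordered_set_partition_cyclic_coarsening[OF S] by (simp add: ordered_set_partition_def)
    ultimately show ?thesis by blast
  qed
  then have "cyclic_coarsenings n \<subseteq> {S. set S \<subseteq> Pow {1..n} \<and> length S \<le> n}" by blast
  then show ?thesis
    by (rule finite_subset) (simp add: finite_lists_length_le)
qed

end

theory Submission
  imports Defs
begin

text \<open>
  A facet normal \<open>v\<close> of a full-dimensional Minkowski sum is rigid: a functional that is constant on
  the \<open>v\<close>-maximal face of every summand is a multiple of \<open>v\<close>. So for every \<open>v\<close> it suffices to find
  one root that is constant on these faces.

  \<open>Delta e S\<close> is a simplex whose vertices are partial sums of projected indicator vectors of blocks,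
  and rotating the blocks translates it. With the big block in front, it is a translate of the
  convex hull of consecutive points of one path \<open>P\<close>, whose steps are the projected unit vectors in the
  cyclic order of \<open>1, \<dots>, N\<close>; here \<open>N = n\<close>, and \<open>N = n - 1\<close> for \<open>D_hat\<close>. Hence a root \<open>u\<close> is constant
  on all \<open>v\<close>-maximal faces once \<open>u \<bullet> P\<close> takes equal values at any two positions that lie on the same
  level of \<open>W = v \<bullet> P\<close> and between which \<open>W\<close> does not exceed this level. If \<open>W\<close> is periodic, the
  letters at both ends of a maximal run of minima give such a root \<open>e_i - e_j\<close>. If \<open>W\<close> has a drift,
  which only happens for \<open>D_hat\<close>, the letter at a strict record gives such a root \<open>e_i - e_n\<close>.
\<close>

section \<open>Facet normals of Minkowski sums\<close>

lemma affine_hull_facet_hyperplane: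
  fixes P :: "'a::euclidean_space set"
  assumes F: "F facet_of P" "F \<subseteq> {x. v \<bullet> x = b}" and P: "\<not> P \<subseteq> {x. v \<bullet> x = b}"
  shows "affine hull F = affine hull P \<inter> {x. v \<bullet> x = b}"
proof (rule affine_dim_equal)
  let ?A = "affine hull P \<inter> {x. v \<bullet> x = b}"
  show "affine ?A" by (intro affine_Int affine_affine_hull affine_hyperplane)
  have "F \<noteq> {}" "F \<subseteq> P" and dim: "aff_dim F = aff_dim P - 1"
    using F(1) by (auto simp: facet_of_def face_of_imp_subset)
  then show "affine hull F \<noteq> {}" by simp
  have "F \<subseteq> ?A" using \<open>F \<subseteq> P\<close> F(2) hull_subset[of P affine] by blast
  then show "affine hull F \<subseteq> ?A" using \<open>affine ?A\<close> by (rule hull_minimal)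
  have "\<not> affine hull P \<subseteq> {x. v \<bullet> x = b}" using P hull_subset[of P affine] by blast
  moreover have "?A \<noteq> {}" using \<open>F \<subseteq> ?A\<close> \<open>F \<noteq> {}\<close> by blast
  ultimately have "aff_dim ?A = aff_dim P - 1"
    using aff_dim_affine_Int_hyperplane[OF affine_affine_hull, of P v b]
    by (simp add: aff_dim_affine_hull)
  then show "aff_dim (affine hull F) = aff_dim ?A" by (simp add: dim)
qed (rule affine_affine_hull)

lemma facet_normal_parallel:
  fixes P :: "'a::euclidean_space set"
  assumes F: "F facet_of P" "F \<subseteq> {x. v \<bullet> x = b}" and P0: "0 \<in> P"
    and v: "v \<in> span P" "v \<noteq> 0" and u: "u \<in> span P" "(\<bullet>) u constant_on F"
  shows "\<exists>c. u = c *\<^sub>R v"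
proof -
  have hullP: "affine hull P = span P" using P0 by (simp add: affine_hull_span_0 hull_inc)
  have "\<not> P \<subseteq> {x. v \<bullet> x = b}"
  proof
    assume "P \<subseteq> {x. v \<bullet> x = b}"
    then have "affine hull P \<subseteq> {x. v \<bullet> x = b}" by (rule hull_minimal) (rule affine_hyperplane)
    then have "v \<bullet> v = b" "v \<bullet> 0 = b" using v(1) span_0 unfolding hullP by blast+
    with v(2) show False by simp
  qed
  then have hullF: "affine hull F = span P \<inter> {x. v \<bullet> x = b}"
    using affine_hull_facet_hyperplane[OF F] by (simp add: hullP)
  obtain x0 where x0: "x0 \<in> F" using F(1) by (auto simp: facet_of_def)
  have "F \<subseteq> {x. u \<bullet> x = u \<bullet> x0}" using u(2) x0 unfolding constant_on_def by auto
  then have const: "affine hull F \<subseteq> {x. u \<bullet> x = u \<bullet> x0}"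
    by (rule hull_minimal) (rule affine_hyperplane)
  define w where "w = u - (u \<bullet> v / (v \<bullet> v)) *\<^sub>R v"
  have orth: "v \<bullet> w = 0" using v(2) by (simp add: w_def inner_diff_right inner_commute)
  have "w \<in> span P" unfolding w_def using u(1) v(1) by (intro span_diff span_scale)
  then have "x0 + w \<in> affine hull F"
    using hull_inc[OF x0, of affine] orth unfolding hullF by (auto simp: inner_add_right span_add)
  then have "u \<bullet> w = 0" using const by (auto simp: inner_add_right)
  then have "w \<bullet> w = 0" using orth by (simp add: w_def inner_diff_left)
  then show ?thesis by (auto simp: w_def)
qed

definition max_face :: "'a::real_inner \<Rightarrow> 'a set \<Rightarrow> 'a set" where
  "max_face v D = {x \<in> D. \<forall>y\<in>D. v \<bullet> y \<le> v \<bullet> x}"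

lemma max_face_eq_Int_hyperplane:
  assumes "P \<subseteq> {x. v \<bullet> x \<le> b}" "P \<inter> {x. v \<bullet> x = b} \<noteq> {}"
  shows "P \<inter> {x. v \<bullet> x = b} = max_face v P"
  using assms by (fastforce simp: max_face_def)

lemma max_face_translation: "max_face v ((+) c ` D) = (+) c ` max_face v D"
  by (auto simp: max_face_def inner_add_right)

lemma constant_on_max_face_translation:
  assumes "(\<bullet>) u constant_on max_face v D"
  shows "(\<bullet>) u constant_on max_face v ((+) c ` D)"
  using assms by (auto simp: constant_on_def max_face_translation inner_add_right)

lemma constant_on_max_face_convex_hull:
  fixes V :: "'a::euclidean_space set"
  assumes V: "compact V" and const: "(\<bullet>) u constant_on max_face v V"
  shows "(\<bullet>) u constant_on max_face v (convex hull V)"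
proof (cases "max_face v (convex hull V) = {}")
  case False
  then obtain x where x: "x \<in> max_face v (convex hull V)" by blast
  then have "convex hull V \<subseteq> {z. v \<bullet> z \<le> v \<bullet> x}" "convex hull V \<inter> {z. v \<bullet> z = v \<bullet> x} \<noteq> {}"
    by (auto simp: max_face_def)
  then have "max_face v (convex hull V) face_of convex hull V"
    using face_of_Int_supporting_hyperplane_le[of "convex hull V" v "v \<bullet> x"]
      max_face_eq_Int_hyperplane by (metis convex_convex_hull mem_Collect_eq subsetD)
  then obtain V' where V': "V' \<subseteq> V" "max_face v (convex hull V) = convex hull V'"
    using face_of_convex_hull_subset[OF V] by blast
  have "V' \<subseteq> max_face v V"
    using V' hull_subset[of V' convex] hull_subset[of V convex] unfolding max_face_def by blast
  moreover obtain c where "max_face v V \<subseteq> {z. u \<bullet> z = c}"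
    using const by (auto simp: constant_on_def)
  ultimately have "convex hull V' \<subseteq> {z. u \<bullet> z = c}"
    by (intro hull_minimal convex_hyperplane) blast
  then show ?thesis unfolding V'(2) constant_on_def by blast
qed (simp add: constant_on_def)

lemma max_face_sum:
  assumes I: "finite I" "i \<in> I" and s: "\<And>i. i \<in> I \<Longrightarrow> s i \<in> D i"
    and max: "(\<Sum>i\<in>I. s i) \<in> max_face v (\<Sum>i\<in>I. D i)"
  shows "s i \<in> max_face v (D i)"
proof -
  have "v \<bullet> z \<le> v \<bullet> s i" if z: "z \<in> D i" for z
  proof -
    have "(\<Sum>j\<in>I. (s(i := z)) j) \<in> (\<Sum>i\<in>I. D i)"
      unfolding set_sum_alt[OF I(1)] using s z by (auto intro!: exI[of _ "s(i := z)"])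
    then have "v \<bullet> (\<Sum>j\<in>I. (s(i := z)) j) \<le> v \<bullet> (\<Sum>i\<in>I. s i)"
      using max by (auto simp: max_face_def)
    then show ?thesis using I by (simp add: sum.remove[of I i] inner_add_right)
  qed
  then show ?thesis using I(2) s by (simp add: max_face_def)
qed

lemma constant_on_max_face_sum:
  assumes I: "finite I" and const: "\<And>i. i \<in> I \<Longrightarrow> (\<bullet>) u constant_on max_face v (D i)"
  shows "(\<bullet>) u constant_on max_face v (\<Sum>i\<in>I. D i)"
proof -
  from const obtain c where u_eq: "\<And>i x. i \<in> I \<Longrightarrow> x \<in> max_face v (D i) \<Longrightarrow> u \<bullet> x = c i"
    unfolding constant_on_def by metis
  have "u \<bullet> x = (\<Sum>i\<in>I. c i)" if x: "x \<in> max_face v (\<Sum>i\<in>I. D i)" for x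
  proof -
    from x have "x \<in> (\<Sum>i\<in>I. D i)" by (simp add: max_face_def)
    then obtain s where x_eq: "x = (\<Sum>i\<in>I. s i)" and s: "\<And>i. i \<in> I \<Longrightarrow> s i \<in> D i"
      unfolding set_sum_alt[OF I] by blast
    have "s i \<in> max_face v (D i)" if "i \<in> I" for i
      by (rule max_face_sum[OF I that]) (use s x x_eq in auto)
    then have "u \<bullet> s i = c i" if "i \<in> I" for i using u_eq that by blast
    then show ?thesis by (simp add: x_eq inner_sum_right)
  qed
  then show ?thesis by (auto simp: constant_on_def)
qed

lemma polytope_sum:
  fixes D :: "'i \<Rightarrow> 'a::euclidean_space set"
  assumes "finite I" "\<And>i. i \<in> I \<Longrightarrow> polytope (D i)"
  shows "polytope (\<Sum>i\<in>I. D i)"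
proof -
  from assms(2) obtain V where V: "\<And>i. i \<in> I \<Longrightarrow> finite (V i) \<and> D i = convex hull V i"
    unfolding polytope_def by metis
  then have "(\<Sum>i\<in>I. D i) = convex hull (\<Sum>i\<in>I. V i)" by (simp add: convex_hull_set_sum)
  moreover have "finite (\<Sum>i\<in>I. V i)"
    using assms(1) V by (induction I rule: finite_induct) (auto intro: finite_set_plus)
  ultimately show ?thesis by (simp add: polytope_convex_hull)
qed

lemma subset_set_sum:
  fixes D :: "'i \<Rightarrow> 'a::comm_monoid_add set"
  assumes "finite I" "i \<in> I" "\<And>j. j \<in> I \<Longrightarrow> 0 \<in> D j"
  shows "D i \<subseteq> (\<Sum>j\<in>I. D j)"
proof
  fix x assume "x \<in> D i"
  then have "(\<Sum>j\<in>I. if j = i then x else 0) \<in> (\<Sum>j\<in>I. D j)"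
    unfolding set_sum_alt[OF assms(1)] using assms(3)
    by (auto intro!: exI[of _ "\<lambda>j. if j = i then x else 0"])
  then show "x \<in> (\<Sum>j\<in>I. D j)" using assms(1,2) by simp
qed

lemma subspace_sum_zero_space: "subspace (sum_zero_space :: (real ^ 'n) set)"
proof -
  have "sum_zero_space = {x :: real ^ 'n. 1 \<bullet> x = 0}"
    by (simp add: sum_zero_space_def inner_vec_def)
  then show ?thesis using subspace_hyperplane by metis
qed

lemma type_A_root_in_sum_zero_space: "type_A_root i j \<in> (sum_zero_space :: (real ^ 'n) set)"
  by (simp add: sum_zero_space_def type_A_root_def axis_def sum_subtractf)

lemma type_A_root_nonzero: "i \<noteq> j \<Longrightarrow> type_A_root i j \<noteq> 0"
  by (auto simp: type_A_root_def axis_eq_axis)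

lemma alcoved_sumI:
  fixes D :: "'i \<Rightarrow> (real ^ 'n) set"
  assumes I: "finite I"
    and poly: "\<And>i. i \<in> I \<Longrightarrow> polytope (D i)"
    and D0: "\<And>i. i \<in> I \<Longrightarrow> 0 \<in> D i"
    and span: "span (\<Union>i\<in>I. D i) = sum_zero_space"
    and root: "\<And>v. v \<in> sum_zero_space \<Longrightarrow> v \<noteq> 0 \<Longrightarrow>
      \<exists>a b. a \<noteq> b \<and> (\<forall>i\<in>I. (\<bullet>) (type_A_root a b) constant_on max_face v (D i))"
  shows "alcoved (\<Sum>i\<in>I. D i)"
proof -
  let ?P = "\<Sum>i\<in>I. D i"
  have sub: "?P \<subseteq> sum_zero_space"
    unfolding set_sum_alt[OF I] span[symmetric] by (auto intro!: span_sum intro: span_base)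
  have P0: "0 \<in> ?P" unfolding set_sum_alt[OF I] using D0 by (auto intro!: exI[of _ "\<lambda>_. 0"])
  have "(\<Union>i\<in>I. D i) \<subseteq> ?P" using subset_set_sum[of I _ D] I D0 by blast
  then have spanP: "span ?P = sum_zero_space"
    using span_mono[of "\<Union>i\<in>I. D i" ?P] span_minimal[OF sub subspace_sum_zero_space] span
    by blast
  have "\<exists>a b c. a \<noteq> b \<and> v = c *\<^sub>R type_A_root a b" if "facet_normal ?P F v" for F v
  proof -
    from that obtain d where F: "F facet_of ?P" and v: "v \<in> sum_zero_space" "v \<noteq> 0"
      and bound: "?P \<subseteq> {x. v \<bullet> x \<le> d}" and F_eq: "F = ?P \<inter> {x. v \<bullet> x = d}"
      by (auto simp: facet_normal_def)
    from root[OF v] obtain a b where "a \<noteq> b"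
      and "\<And>i. i \<in> I \<Longrightarrow> (\<bullet>) (type_A_root a b) constant_on max_face v (D i)"
      by blast
    then have "(\<bullet>) (type_A_root a b) constant_on max_face v ?P"
      by (intro constant_on_max_face_sum[OF I])
    moreover have "F \<noteq> {}" using F by (auto simp: facet_of_def)
    then have "F = max_face v ?P" using max_face_eq_Int_hyperplane[OF bound] F_eq by simp
    ultimately obtain c where root_eq: "type_A_root a b = c *\<^sub>R v"
      using facet_normal_parallel[OF F _ P0, of v d "type_A_root a b"] v F_eq
        type_A_root_in_sum_zero_space unfolding spanP by blast
    then have "c \<noteq> 0" using type_A_root_nonzero[OF \<open>a \<noteq> b\<close>] root_eq by auto
    then have "v = (1 / c) *\<^sub>R type_A_root a b" using root_eq by simp
    with \<open>a \<noteq> b\<close> show ?thesis by blast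
  qed
  then show ?thesis using polytope_sum[OF I poly] sub by (auto simp: alcoved_def)
qed

section \<open>Peaks of quasi-periodic functions\<close>

lemma int_constI:
  fixes g :: "int \<Rightarrow> 'a"
  assumes "\<And>p. g (p + 1) = g p"
  shows "g p = g q"
proof -
  have "g p = g 0" for p
  proof (induction p rule: int_induct[of _ 0])
    case (step2 i)
    then show ?case using assms[of "i - 1"] by simp
  qed (simp_all add: assms)
  then show ?thesis by metis
qed

lemma periodic_mult:
  fixes f :: "int \<Rightarrow> 'a"
  assumes "\<And>p. f (p + N) = f p"
  shows "f (p + N * t) = f p"
proof -
  have "f (p + N * (t + 1)) = f (p + N * t)" for t
    using assms[of "p + N * t"] by (simp add: algebra_simps)
  then have "f (p + N * t) = f (p + N * 0)" by (rule int_constI)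
  then show ?thesis by simp
qed

lemma quasi_periodic_mult:
  fixes W :: "int \<Rightarrow> 'a::ring_1"
  assumes "\<And>p. W (p + N) = W p + c"
  shows "W (p + N * t) = W p + of_int t * c"
proof -
  have "W (p + N * (t + 1)) = W (p + N * t) + c" for t
    using assms[of "p + N * t"] by (simp add: algebra_simps)
  then have "W (p + N * (t + 1)) - of_int (t + 1) * c = W (p + N * t) - of_int t * c" for t
    by (simp add: distrib_right)
  then have "W (p + N * t) - of_int t * c = W (p + N * 0) - of_int 0 * c" by (rule int_constI)
  then show ?thesis by (simp add: algebra_simps)
qed

definition peak_constant :: "(int \<Rightarrow> 'a::linorder) \<Rightarrow> (int \<Rightarrow> 'b) \<Rightarrow> bool" where
  "peak_constant W U \<longleftrightarrow>
     (\<forall>p q. p \<le> q \<longrightarrow> W p = W q \<longrightarrow> (\<forall>r\<in>{p..q}. W r \<le> W p) \<longrightarrow> U p = U q)"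

lemma peak_constantD:
  assumes "peak_constant W U" "p \<in> {a..b}" "q \<in> {a..b}"
    and "\<And>r. r \<in> {a..b} \<Longrightarrow> W r \<le> W p" "\<And>r. r \<in> {a..b} \<Longrightarrow> W r \<le> W q"
  shows "U p = U q"
proof -
  have "W p = W q" using assms(2-5) by (simp add: order.antisym)
  moreover have "U x = U y"
    if "x \<le> y" "x \<in> {a..b}" "y \<in> {a..b}" "W x = W y" "\<And>r. r \<in> {a..b} \<Longrightarrow> W r \<le> W x" for x y
    using assms(1) that unfolding peak_constant_def by simp
  ultimately show ?thesis using assms(2-5) by (metis linear)
qed

lemma peak_constant_of_int_diff:
  fixes U :: "int \<Rightarrow> int" and U' :: "int \<Rightarrow> 'b::ring_1"
  assumes "peak_constant W U" and diff: "\<And>p. U' (p + 1) - U' p = of_int (U (p + 1) - U p)"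
  shows "peak_constant W U'"
proof -
  have "U' p - of_int (U p) = U' q - of_int (U q)" for p q
    by (rule int_constI[of "\<lambda>p. U' p - of_int (U p)"]) (use diff in \<open>simp add: algebra_simps\<close>)
  then show ?thesis
    using assms(1) unfolding peak_constant_def by (metis diff_add_cancel)
qed

lemma div_eq_if_no_multiple_between:
  fixes p q k N :: int
  assumes "0 < N" "p \<le> q" and none: "\<And>t. p < k + N * t \<Longrightarrow> k + N * t \<le> q \<Longrightarrow> False"
  shows "(p - k) div N = (q - k) div N"
proof (rule ccontr)
  define t where "t = (q - k) div N"
  assume "(p - k) div N \<noteq> (q - k) div N"
  moreover have "(p - k) div N \<le> (q - k) div N" using assms by (intro zdiv_mono1) auto
  ultimately have "(p - k) div N < t" by (simp add: t_def)
  then have "N * ((p - k) div N + 1) \<le> N * t" using \<open>0 < N\<close> by (intro mult_left_mono) auto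
  then have "p < k + N * t"
    using pos_mod_bound[OF \<open>0 < N\<close>, of "p - k"] mult_div_mod_eq[of N "p - k"]
    unfolding distrib_left by linarith
  moreover have "k + N * t \<le> q"
    using pos_mod_sign[OF \<open>0 < N\<close>, of "q - k"] mult_div_mod_eq[of N "q - k"]
    unfolding t_def by linarith
  ultimately show False by (rule none)
qed

lemma exists_strict_record:
  fixes W :: "int \<Rightarrow> 'a::linordered_idom"
  assumes N: "0 < N" and per: "\<And>p. W (p + N) = W p + c" and "0 < c"
  obtains k where "\<And>p. p < k \<Longrightarrow> W p < W k"
proof -
  define M where "M = Max (W ` {0..<N})"
  have le_M: "W p \<le> M" if "p \<in> {0..<N}" for p using that by (simp add: M_def)
  define K where "K = {p \<in> {0..<N}. W p = M}"
  have "M \<in> W ` {0..<N}" unfolding M_def using N by (intro Max_in) auto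
  then have "K \<noteq> {}" by (auto simp: K_def)
  moreover have "finite K" unfolding K_def by (rule finite_subset[of _ "{0..<N}"]) auto
  ultimately have Min_K: "Min K \<in> K" by (intro Min_in)
  have "W p < W (Min K)" if p: "p < Min K" for p
  proof (cases "p \<in> {0..<N}")
    case True
    have "p \<notin> K" using p Min_le[OF \<open>finite K\<close>, of p] by (meson not_le)
    then show ?thesis using True le_M[OF True] Min_K by (auto simp: K_def)
  next
    case False
    then have "p < 0" using p Min_K by (auto simp: K_def)
    then have "p div N < 0" using N by (simp add: div_neg_pos_less0)
    then have "of_int (p div N) * c < 0" using \<open>0 < c\<close> by (simp add: mult_neg_pos)
    moreover have "W p = W (p mod N) + of_int (p div N) * c"
      using quasi_periodic_mult[of W N c "p mod N" "p div N", OF per] by simp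
    moreover have "W (p mod N) \<le> M" using N by (intro le_M) simp
    ultimately show ?thesis using Min_K by (simp add: K_def)
  qed
  then show ?thesis by (rule that)
qed

lemma peak_constant_increasing:
  fixes W :: "int \<Rightarrow> 'a::linordered_idom"
  assumes N: "0 < N" and per: "\<And>p. W (p + N) = W p + c" and "0 < c"
  obtains k where "peak_constant W (\<lambda>p. (p - k) div N)"
proof -
  note shift = quasi_periodic_mult[of W N c, OF per]
  obtain k where below: "\<And>p. p < k \<Longrightarrow> W p < W k"
    using exists_strict_record[of N W c] assms by blast
  have False if "p < k + N * t" "k + N * t \<le> q" "\<forall>r\<in>{p..q}. W r \<le> W p" for p q t
  proof -
    have "W p < W (k + N * t)"
      using below[of "p - N * t"] that(1) shift[of "p - N * t" t] shift[of k t] by simp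
    moreover have "k + N * t \<in> {p..q}" using that(1,2) by simp
    ultimately show False using that(3) by (meson not_le)
  qed
  then show ?thesis
    using that[of k] div_eq_if_no_multiple_between[OF N] unfolding peak_constant_def by metis
qed

lemma peak_constant_decreasing:
  fixes W :: "int \<Rightarrow> 'a::linordered_idom"
  assumes N: "0 < N" and per: "\<And>p. W (p + N) = W p + c" and "c < 0"
  obtains k where "peak_constant W (\<lambda>p. (p - k) div N)"
proof -
  note shift = quasi_periodic_mult[of W N c, OF per]
  have "W (- (p + N)) = W (- p) - c" for p using per[of "- (p + N)"] by simp
  with N \<open>c < 0\<close> obtain k' where mirrored: "\<And>p. p < k' \<Longrightarrow> W (- p) < W (- k')"
    using exists_strict_record[of N "\<lambda>p. W (- p)" "- c"] by fastforce
  define k where "k = 1 - k'"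
  have above: "W p < W (k - 1)" if "k - 1 < p" for p
    using mirrored[of "- p"] that by (simp add: k_def)
  have False
    if "p < k + N * t" "k + N * t \<le> q" "W p = W q" "\<forall>r\<in>{p..q}. W r \<le> W p" for p q t
  proof -
    have "W q < W (k - 1 + N * t)"
      using above[of "q - N * t"] that(2) shift[of "q - N * t" t] shift[of "k - 1" t] by simp
    moreover have "k - 1 + N * t \<in> {p..q}" using that(1,2) by simp
    ultimately show False using that(3,4) by (metis not_le)
  qed
  then show ?thesis
    using that[of k] div_eq_if_no_multiple_between[OF N] unfolding peak_constant_def by metis
qed

lemma exists_maximal_run:
  fixes Q :: "int \<Rightarrow> bool"
  assumes N: "0 < N" and per: "\<And>p. Q (p + N) = Q p" and "Q a" "\<not> Q b"
  obtains k l where "k < l" "l < k + N" "\<not> Q (k - 1)" "\<not> Q l" "\<And>r. k \<le> r \<Longrightarrow> r < l \<Longrightarrow> Q r"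
proof -
  define K where "K = {r. b \<le> r \<and> r \<le> b + (a - b) mod N \<and> Q r}"
  have "Q (b + (a - b) mod N)"
    using periodic_mult[of Q N "b + (a - b) mod N" "(a - b) div N", OF per] \<open>Q a\<close>
    by (simp add: add.assoc)
  then have "b + (a - b) mod N \<in> K" using N by (simp add: K_def)
  moreover have "finite K"
    unfolding K_def by (rule finite_subset[of _ "{b..b + (a - b) mod N}"]) auto
  ultimately have "Min K \<in> K" by (intro Min_in) auto
  moreover have "Min K - 1 \<notin> K" using Min_le[OF \<open>finite K\<close>, of "Min K - 1"] by auto
  ultimately have Min_K: "Q (Min K)" "\<not> Q (Min K - 1)"
    using \<open>\<not> Q b\<close> by (auto simp: K_def le_less)
  define L where "L = {r. Min K \<le> r \<and> r < Min K + N \<and> \<not> Q r}"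
  have "Min K - 1 + N \<in> L" using Min_K(2) per N unfolding L_def by auto
  moreover have "finite L"
    unfolding L_def by (rule finite_subset[of _ "{Min K..<Min K + N}"]) auto
  ultimately have Min_L: "Min L \<in> L" by (intro Min_in) auto
  have "Q r" if "Min K \<le> r" "r < Min L" for r
    using Min_le[OF \<open>finite L\<close>, of r] that Min_L by (force simp: L_def)
  moreover have "Min K < Min L" using Min_L Min_K(1) by (auto simp: L_def le_less)
  ultimately show ?thesis using that[of "Min K" "Min L"] Min_K(2) Min_L by (auto simp: L_def)
qed

lemma div_diff_div_shift:
  fixes x d N :: int
  assumes "0 < d" "d < N"
  shows "x div N - (x - d) div N = of_bool (x mod N < d)"
proof -
  have "0 < N" using assms by simp
  note mod = pos_mod_sign[OF this, of x] pos_mod_bound[OF this, of x] mult_div_mod_eq[of N x]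
  have "(x - d) div N = (if x mod N < d then x div N - 1 else x div N)"
  proof (cases "x mod N < d")
    case True
    have "(x - d) div N = x div N - 1"
      by (rule int_div_pos_eq[where r = "x mod N - d + N"])
        (use assms True mod in \<open>auto simp: algebra_simps\<close>)
    then show ?thesis using True by simp
  next
    case False
    have "(x - d) div N = x div N"
      by (rule int_div_pos_eq[where r = "x mod N - d"])
        (use assms False mod in \<open>auto simp: algebra_simps\<close>)
    then show ?thesis using False by simp
  qed
  then show ?thesis by simp
qed

lemma exists_run_of_minima:
  fixes W :: "int \<Rightarrow> 'a::linorder"
  assumes N: "0 < N" and per: "\<And>p. W (p + N) = W p" and "W a \<noteq> W b"
  obtains k l \<mu> where "k < l" "l < k + N" "\<And>p. \<mu> \<le> W p" "W (k - 1) \<noteq> \<mu>" "W l \<noteq> \<mu>"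
    "\<And>r. k \<le> r \<Longrightarrow> r < l \<Longrightarrow> W r = \<mu>"
proof -
  define \<mu> where "\<mu> = Min (W ` {0..<N})"
  have min: "\<mu> \<le> W p" for p
  proof -
    have "\<mu> \<le> W (p mod N)" unfolding \<mu>_def using N by (intro Min_le) auto
    then show ?thesis using periodic_mult[of W N "p mod N" "p div N", OF per] by simp
  qed
  have "\<mu> \<in> W ` {0..<N}" unfolding \<mu>_def using N by (intro Min_in) auto
  then obtain a' where "W a' = \<mu>" by auto
  moreover obtain b' where "W b' \<noteq> \<mu>" using \<open>W a \<noteq> W b\<close> by metis
  ultimately show ?thesis
    using exists_maximal_run[of N "\<lambda>r. W r = \<mu>" a' b'] N per min that by metis
qed

text \<open>A peak on the minimal level cannot leave the run \<open>{k..<l}\<close> of minima or enter it, and the ends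
  of any other peak lie outside all shifts of the run.\<close>

lemma peak_constant_periodic:
  fixes W :: "int \<Rightarrow> 'a::linorder"
  assumes N: "0 < N" and per: "\<And>p. W (p + N) = W p" and "W a \<noteq> W b"
  obtains k l where "k < l" "l < k + N"
    "peak_constant W (\<lambda>p. (p - k) div N - (p - l) div N)"
proof -
  note shift = periodic_mult[of W N, OF per]
  obtain k l \<mu> where kl: "k < l" "l < k + N" and min: "\<And>p. \<mu> \<le> W p"
    and ends: "W (k - 1) \<noteq> \<mu>" "W l \<noteq> \<mu>" and run: "\<And>r. k \<le> r \<Longrightarrow> r < l \<Longrightarrow> W r = \<mu>"
    using exists_run_of_minima[of N W, OF assms] by blast
  let ?U = "\<lambda>p. (p - k) div N - (p - l) div N"
  have U_off_runs: "?U p = 0" if "W p \<noteq> \<mu>" for p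
  proof -
    have "W (k + (p - k) mod N) = W p"
      using shift[of "k + (p - k) mod N" "(p - k) div N"] by (simp add: add.assoc)
    then have "\<not> (p - k) mod N < l - k" using run[of "k + (p - k) mod N"] that N by force
    then show ?thesis using div_diff_div_shift[of "l - k" N "p - k"] kl by simp
  qed
  have "?U p = ?U q" if "p \<le> q" "W p = W q" "\<forall>r\<in>{p..q}. W r \<le> W p" for p q
  proof (cases "W p = \<mu>")
    case True
    then have flat: "W r = \<mu>" if "p \<le> r" "r \<le> q" for r
      using that \<open>\<forall>r\<in>{p..q}. W r \<le> W p\<close> min[of r] by (simp add: order.antisym)
    have "(p - k) div N = (q - k) div N"
    proof (rule div_eq_if_no_multiple_between[OF N \<open>p \<le> q\<close>])
      fix t assume "p < k + N * t" "k + N * t \<le> q"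
      then have "W (k - 1 + N * t) = \<mu>" by (intro flat) auto
      then show False using ends(1) by (simp add: shift)
    qed
    moreover have "(p - l) div N = (q - l) div N"
    proof (rule div_eq_if_no_multiple_between[OF N \<open>p \<le> q\<close>])
      fix t assume "p < l + N * t" "l + N * t \<le> q"
      then have "W (l + N * t) = \<mu>" by (intro flat) auto
      then show False using ends(2) by (simp add: shift)
    qed
    ultimately show ?thesis by simp
  next
    case False
    then show ?thesis using U_off_runs[of p] U_off_runs[of q] \<open>W p = W q\<close> by simp
  qed
  then have "peak_constant W (\<lambda>p. ?U p)" unfolding peak_constant_def by simp
  then show ?thesis using that kl by simp
qed

lemma div_add_one_diff:
  fixes p k N :: int
  assumes "0 < N"
  shows "(p + 1 - k) div N - (p - k) div N = of_bool (p mod N = (k - 1) mod N)"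
proof (cases "N = 1")
  case False
  then have "(p + 1 - k) div N - (p + 1 - k - 1) div N = of_bool ((p + 1 - k) mod N < 1)"
    using assms by (intro div_diff_div_shift) auto
  also have "(p + 1 - k) mod N < 1 \<longleftrightarrow> (p + 1 - k) mod N = 0"
    using pos_mod_sign[OF assms, of "p + 1 - k"] by linarith
  also have "\<dots> \<longleftrightarrow> p mod N = (k - 1) mod N"
    using mod_eq_dvd_iff[of p N "k - 1"] by (simp add: mod_eq_0_iff_dvd algebra_simps)
  finally show ?thesis by (simp add: algebra_simps)
qed simp

section \<open>The simplices of ordered set partitions\<close>

definition centered_axis :: "'n \<Rightarrow> real ^ 'n" where
  "centered_axis a = (\<chi> b. of_bool (b = a) - 1 / CARD('n))"

lemma centered_axis_in_sum_zero_space: "centered_axis a \<in> (sum_zero_space :: (real ^ 'n) set)"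
  by (simp add: sum_zero_space_def centered_axis_def sum_subtractf of_bool_def)

lemma inner_centered_axis:
  fixes u :: "real ^ 'n"
  assumes "u \<in> sum_zero_space"
  shows "u \<bullet> centered_axis a = u $ a"
proof -
  have "u \<bullet> centered_axis a
      = (\<Sum>b\<in>UNIV. u $ b * of_bool (b = a)) - (\<Sum>b\<in>UNIV. u $ b) / CARD('n)"
    by (simp add: inner_vec_def centered_axis_def right_diff_distrib sum_subtractf
        sum_divide_distrib)
  then show ?thesis
    using assms by (simp add: sum_zero_space_def of_bool_def if_distrib cong: if_cong)
qed

lemma sum_zero_space_expansion:
  fixes x :: "real ^ 'n"
  assumes "x \<in> sum_zero_space"
  shows "x = (\<Sum>a\<in>UNIV. x $ a *\<^sub>R centered_axis a)"
proof -
  have "(\<Sum>a\<in>UNIV. x $ a * of_bool (b = a)) = x $ b" for b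
    by (simp add: of_bool_def if_distrib cong: if_cong)
  then show ?thesis
    using assms
    by (simp add: vec_eq_iff centered_axis_def right_diff_distrib sum_subtractf
        sum_zero_space_def flip: sum_divide_distrib)
qed

lemma eq_0_if_constant_coordinates:
  fixes x :: "real ^ 'n"
  assumes "x \<in> sum_zero_space" "\<And>a. x $ a = c"
  shows "x = 0"
  using assms by (simp add: sum_zero_space_def vec_eq_iff)

lemma ordered_set_partition_rotate:
  assumes "ordered_set_partition n S"
  shows "ordered_set_partition n (rotate k S)"
proof -
  have "rotate k S ! i \<inter> rotate k S ! j = {}"
    if "i < length S" "j < length S" "i \<noteq> j" for i j
  proof -
    have "(k + i) mod length S \<noteq> (k + j) mod length S"
      using that nth_eq_iff_index_eq[of "rotate k [0..<length S]" i j] by (auto simp: nth_rotate)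
    moreover have "0 < length S" using that(1) by linarith
    then have "(k + i) mod length S < length S" "(k + j) mod length S < length S" by simp_all
    ultimately show ?thesis using that assms by (simp add: nth_rotate ordered_set_partition_def)
  qed
  then show ?thesis using assms by (simp add: ordered_set_partition_def)
qed

lemma zero_in_Delta: "0 \<in> Delta e S"
  by (simp add: Delta_def sum_zero_space_def)

lemma convex_Delta: "convex (Delta e S)"
proof -
  have convex_eq: "convex {x :: real ^ 'n. x $ a = x $ b}" for a b
    using convex_hyperplane[of "axis a 1 - axis b 1 :: real ^ 'n" 0]
    by (simp add: inner_diff_left inner_axis')
  have convex_le: "convex {x :: real ^ 'n. x $ a - c \<le> x $ b}" for a b c
    using convex_halfspace_le[of "axis a 1 - axis b 1 :: real ^ 'n" c]
    by (simp add: inner_diff_left inner_axis' algebra_simps)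
  have "Delta e S = sum_zero_space
      \<inter> (\<Inter>B\<in>set S. \<Inter>i\<in>B. \<Inter>j\<in>B. {x. x $ e i = x $ e j})
      \<inter> (\<Inter>k\<in>{k. Suc k < length S}. \<Inter>i\<in>S ! k. \<Inter>j\<in>S ! Suc k. {x. x $ e j - 0 \<le> x $ e i})
      \<inter> (\<Inter>i\<in>last S. \<Inter>j\<in>hd S. {x. x $ e j - 1 \<le> x $ e i})"
    by (simp add: Delta_def set_eq_iff)
  then show ?thesis
    by (simp only:)
      (intro convex_Int convex_INT convex_eq convex_le subspace_imp_convex
        subspace_sum_zero_space)
qed

locale labelling =
  fixes e :: "nat \<Rightarrow> 'n::finite" and n :: nat
  assumes card_eq: "n = CARD('n)" and bij: "bij_betw e {1..n} (UNIV :: 'n set)"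
begin

definition block_vector :: "nat set \<Rightarrow> real ^ 'n" where
  "block_vector B = (\<Sum>i\<in>B. centered_axis (e i))"

definition vertex :: "nat set list \<Rightarrow> nat \<Rightarrow> real ^ 'n" where
  "vertex S k = (\<Sum>j<k. block_vector (S ! j))"

lemma n_pos: "0 < n"
  by (simp add: card_eq)

lemma obtain_label:
  obtains i where "i \<in> {1..n}" "a = e i"
  using bij by (metis bij_betw_def UNIV_I image_iff)

lemma label_eq_iff: "i \<in> {1..n} \<Longrightarrow> j \<in> {1..n} \<Longrightarrow> e i = e j \<longleftrightarrow> i = j"
  using bij by (auto simp: bij_betw_def inj_on_eq_iff)

lemma sum_UNIV: "(\<Sum>a\<in>UNIV. h a) = (\<Sum>i=1..n. h (e i))"
  using sum.reindex_bij_betw[OF bij, of h] by simp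

lemma block_vector_singleton: "block_vector {i} = centered_axis (e i)"
  by (simp add: block_vector_def)

lemma block_vector_in_sum_zero_space: "block_vector B \<in> sum_zero_space"
  unfolding block_vector_def
  by (intro subspace_sum subspace_sum_zero_space centered_axis_in_sum_zero_space)

lemma vertex_in_sum_zero_space: "vertex S k \<in> sum_zero_space"
  unfolding vertex_def
  by (intro subspace_sum subspace_sum_zero_space block_vector_in_sum_zero_space)

lemma block_vector_nth:
  assumes "B \<subseteq> {1..n}" "i \<in> {1..n}"
  shows "block_vector B $ e i = of_bool (i \<in> B) - card B / n"
proof -
  have "finite B" using assms(1) finite_subset by blast
  have "block_vector B $ e i = (\<Sum>j\<in>B. of_bool (j = i) - 1 / n)"
    unfolding block_vector_def using assms label_eq_iff
    by (auto simp: centered_axis_def simp flip: card_eq intro!: sum.cong)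
  then show ?thesis using \<open>finite B\<close> by (simp add: sum_subtractf of_bool_def)
qed

context
  fixes S assumes S: "ordered_set_partition n S"
begin

lemma length_pos: "0 < length S"
  using S n_pos by (cases S) (auto simp: ordered_set_partition_def)

lemma nth_block_subset: "j < length S \<Longrightarrow> S ! j \<subseteq> {1..n}"
  using S nth_mem unfolding ordered_set_partition_def by blast

lemma nth_block_unique:
  "i \<in> S ! j \<Longrightarrow> i \<in> S ! k \<Longrightarrow> j < length S \<Longrightarrow> k < length S \<Longrightarrow> j = k"
  using S unfolding ordered_set_partition_def by blast

lemma obtain_block:
  assumes "i \<in> {1..n}"
  obtains j where "j < length S" "i \<in> S ! j"
  using S assms unfolding ordered_set_partition_def by (metis UnionE in_set_conv_nth)

lemma vertex_nth:
  assumes "j < length S" "i \<in> S ! j" "k \<le> length S"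
  shows "vertex S k $ e i = of_bool (j < k) - (\<Sum>j<k. real (card (S ! j))) / n"
proof -
  have "block_vector (S ! j') $ e i = of_bool (j' = j) - card (S ! j') / n" if "j' < k" for j'
  proof -
    have "i \<in> S ! j' \<longleftrightarrow> j' = j" using assms that nth_block_unique by auto
    then show ?thesis
      using block_vector_nth[of "S ! j'" i] nth_block_subset[of j'] nth_block_subset[of j] assms
        that
      by auto
  qed
  then have "vertex S k $ e i = (\<Sum>j'<k. of_bool (j' = j) - card (S ! j') / n)"
    by (simp add: vertex_def)
  then show ?thesis by (simp add: sum_subtractf sum_divide_distrib of_bool_def)
qed

lemma vertex_length: "vertex S (length S) = 0"
proof (rule eq_0_if_constant_coordinates[OF vertex_in_sum_zero_space])
  fix a
  obtain i j where "a = e i" "j < length S" "i \<in> S ! j" using obtain_label obtain_block by metis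
  then show "vertex S (length S) $ a = 1 - (\<Sum>j<length S. real (card (S ! j))) / n"
    by (simp add: vertex_nth)
qed

lemma vertex_in_Delta:
  assumes "k \<le> length S"
  shows "vertex S k \<in> Delta e S"
proof -
  have antimono: "vertex S k $ e i \<ge> vertex S k $ e i'"
    if "i \<in> S ! j" "i' \<in> S ! j'" "j < length S" "j' < length S" "j \<le> j'" for i i' j j'
    using vertex_nth[OF that(3,1) assms] vertex_nth[OF that(4,2) assms] that(5) by simp
  have const: "vertex S k $ e i = vertex S k $ e i'" if "B \<in> set S" "i \<in> B" "i' \<in> B" for B i i'
    using that antimono by (metis in_set_conv_nth order.antisym order.refl)
  have decr: "vertex S k $ e i \<ge> vertex S k $ e i'"
    if "Suc j < length S" "i \<in> S ! j" "i' \<in> S ! Suc j" for i i' j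
    using antimono[OF that(2,3)] that(1) by simp
  have wrap: "vertex S k $ e i \<ge> vertex S k $ e i' - 1" if "i \<in> last S" "i' \<in> hd S" for i i'
    using that assms length_pos vertex_nth[of "length S - 1" i k] vertex_nth[of 0 i' k]
    by (simp add: last_conv_nth hd_conv_nth)
  show ?thesis
    unfolding Delta_def
    by (intro CollectI conjI ballI allI impI vertex_in_sum_zero_space)
      (rule const decr wrap; assumption)+
qed

lemma Delta_block_values:
  assumes "x \<in> Delta e S"
  obtains y where "\<And>j i. j < length S \<Longrightarrow> i \<in> S ! j \<Longrightarrow> x $ e i = y j"
    "\<And>j. j < length S \<Longrightarrow> y (Suc j) \<le> y j" "y (length S) = y 0 - 1"
proof -
  from assms have const: "\<And>B i j. B \<in> set S \<Longrightarrow> i \<in> B \<Longrightarrow> j \<in> B \<Longrightarrow> x $ e i = x $ e j"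
    and decr: "\<And>k i j. Suc k < length S \<Longrightarrow> i \<in> S ! k \<Longrightarrow> j \<in> S ! Suc k \<Longrightarrow> x $ e i \<ge> x $ e j"
    and wrap: "\<And>i j. i \<in> last S \<Longrightarrow> j \<in> hd S \<Longrightarrow> x $ e i \<ge> x $ e j - 1"
    unfolding Delta_def by blast+
  define rep where "rep j = (SOME i. i \<in> S ! j)" for j
  have rep: "rep j \<in> S ! j" if "j < length S" for j
    using S that unfolding rep_def ordered_set_partition_def by (metis some_in_eq nth_mem)
  define y where "y j = (if j < length S then x $ e (rep j) else x $ e (rep 0) - 1)" for j
  have "x $ e i = y j" if "j < length S" "i \<in> S ! j" for i j
    using const[OF nth_mem[OF that(1)] that(2) rep[OF that(1)]] that(1) by (simp add: y_def)
  moreover have "y (Suc j) \<le> y j" if "j < length S" for j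
  proof (cases "Suc j < length S")
    case True
    then show ?thesis using decr[OF True rep rep] that by (simp add: y_def)
  next
    case False
    then have "j = length S - 1" using that by simp
    then have "last S = S ! j" "hd S = S ! 0"
      using length_pos by (simp_all add: last_conv_nth hd_conv_nth)
    then show ?thesis using wrap[of "rep j" "rep 0"] rep[of j] rep[of 0] that False length_pos
      by (simp add: y_def)
  qed
  moreover have "y (length S) = y 0 - 1" using length_pos by (simp add: y_def)
  ultimately show ?thesis by (rule that)
qed

text \<open>The barycentric coordinates of a point are the drops of its values from block to block; the
  combination of the vertices with these weights agrees with the point up to a constant vector.\<close>

lemma Delta_subset_convex_hull: "Delta e S \<subseteq> convex hull (vertex S ` {..length S})"
proof
  fix x assume x: "x \<in> Delta e S"
  obtain y where y: "\<And>j i. j < length S \<Longrightarrow> i \<in> S ! j \<Longrightarrow> x $ e i = y j"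
    and decr: "\<And>j. j < length S \<Longrightarrow> y (Suc j) \<le> y j" and wrap: "y (length S) = y 0 - 1"
    using Delta_block_values[OF x] by blast
  define w where "w k = y k - y (Suc k)" for k
  have nonneg: "0 \<le> w k" if "k < length S" for k using decr[OF that] by (simp add: w_def)
  have tail: "(\<Sum>k=j..<length S. w k) = y j - y (length S)" if "j \<le> length S" for j
    using sum_Suc_diff'[OF that, of "\<lambda>k. - y k"] by (simp add: w_def)
  then have total: "(\<Sum>k<length S. w k) = 1" by (simp add: wrap lessThan_atLeast0)
  let ?z = "\<Sum>k<length S. w k *\<^sub>R vertex S (Suc k)"
  have "x - ?z = 0"
  proof (rule eq_0_if_constant_coordinates)
    show "x - ?z \<in> sum_zero_space"
      by (intro subspace_diff subspace_sum subspace_scale subspace_sum_zero_space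
          vertex_in_sum_zero_space) (use x in \<open>simp add: Delta_def\<close>)
    fix a
    obtain i j where a: "a = e i" "j < length S" "i \<in> S ! j"
      using obtain_label obtain_block by metis
    let ?c = "\<lambda>k. (\<Sum>j<Suc k. real (card (S ! j))) / n"
    have "?z $ a = (\<Sum>k<length S. (if j \<le> k then w k else 0) - w k * ?c k)"
      using a by (auto simp: vertex_nth less_Suc_eq_le algebra_simps intro!: sum.cong)
    also have "\<dots> = (\<Sum>k=j..<length S. w k) - (\<Sum>k<length S. w k * ?c k)"
      unfolding sum_subtractf
      by (subst sum.inter_filter[symmetric]) (auto intro!: arg_cong2[of _ _ _ _ "(-)"] sum.cong)
    finally show "(x - ?z) $ a = y (length S) + (\<Sum>k<length S. w k * ?c k)"
      using tail[of j] y[of j i] a by simp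
  qed
  moreover have "?z \<in> convex hull (vertex S ` {..length S})"
    by (rule convex_sum) (use nonneg total in \<open>auto intro!: hull_inc\<close>)
  ultimately show "x \<in> convex hull (vertex S ` {..length S})" by simp
qed

lemma Delta_eq_convex_hull: "Delta e S = convex hull (vertex S ` {..length S})"
  using Delta_subset_convex_hull vertex_in_Delta convex_Delta
  by (intro subset_antisym hull_minimal) auto

lemma polytope_Delta: "polytope (Delta e S)"
  by (simp add: Delta_eq_convex_hull polytope_convex_hull)

lemma block_vector_in_span_Delta:
  assumes "B \<in> set S"
  shows "block_vector B \<in> span (Delta e S)"
proof -
  obtain j where j: "j < length S" "B = S ! j" using assms by (metis in_set_conv_nth)
  then have "block_vector B = vertex S (Suc j) - vertex S j" by (simp add: vertex_def)
  then show ?thesis using j(1) vertex_in_Delta by (simp add: span_base span_diff)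
qed

end

lemma vertices_Cons:
  assumes "ordered_set_partition n (B # S)"
  shows "vertex (B # S) ` {..length (B # S)} = (+) (block_vector B) ` vertex S ` {..length S}"
proof -
  have step: "vertex (B # S) (Suc k) = block_vector B + vertex S k" for k
    unfolding vertex_def by (subst sum.lessThan_Suc_shift) simp
  have "vertex (B # S) 0 = vertex (B # S) (Suc (length S))"
    using vertex_length[OF assms] by (simp add: vertex_def)
  then show ?thesis
    by (auto simp: step image_image atMost_Suc_eq_insert_0)
qed

lemma vertices_snoc:
  assumes "ordered_set_partition n (S @ [B])"
  shows "vertex (S @ [B]) ` {..length (S @ [B])} = vertex S ` {..length S}"
proof -
  have "vertex (S @ [B]) k = vertex S k" if "k \<le> length S" for k
    unfolding vertex_def using that by (intro sum.cong) (auto simp: nth_append)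
  moreover have "vertex (S @ [B]) (length (S @ [B])) = vertex S 0"
    using vertex_length[OF assms] by (simp add: vertex_def)
  ultimately show ?thesis by (auto simp: atMost_Suc)
qed

lemma Delta_rotate: "ordered_set_partition n S \<Longrightarrow> \<exists>c. Delta e S = (+) c ` Delta e (rotate k S)"
proof (induction k)
  case 0
  show ?case by (auto intro: exI[of _ 0])
next
  case (Suc k)
  let ?T = "rotate k S"
  have T: "ordered_set_partition n ?T" using ordered_set_partition_rotate Suc.prems .
  then obtain B T' where BT: "?T = B # T'" using length_pos by (cases ?T) auto
  then have rot: "rotate (Suc k) S = T' @ [B]" by simp
  have "ordered_set_partition n (T' @ [B])"
    using ordered_set_partition_rotate[OF Suc.prems, of "Suc k"] unfolding rot .
  then have "Delta e ?T = (+) (block_vector B) ` Delta e (rotate (Suc k) S)"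
    using T vertices_Cons[of B T'] vertices_snoc[of T' B]
    by (simp only: BT rot Delta_eq_convex_hull convex_hull_translation)
  moreover obtain c where "Delta e S = (+) c ` Delta e ?T" using Suc by blast
  ultimately have "Delta e S = (+) (c + block_vector B) ` Delta e (rotate (Suc k) S)"
    by (simp add: image_image add.assoc)
  then show ?case by blast
qed

end

section \<open>The path of a cyclic word\<close>

definition cyclic_letter :: "nat \<Rightarrow> int \<Rightarrow> nat" where
  "cyclic_letter N p = Suc (nat (p mod int N))"

lemma cyclic_letter_of_nat: "cyclic_letter N (int j) = Suc (j mod N)"
  by (simp add: cyclic_letter_def flip: zmod_int)

lemma cyclic_letter_add_period: "cyclic_letter N (p + int N) = cyclic_letter N p"
  by (simp add: cyclic_letter_def)

context
  fixes N :: nat assumes N: "0 < N"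
begin

lemma cyclic_letter_in: "cyclic_letter N p \<in> {1..N}"
  using N pos_mod_bound[of "int N" p] pos_mod_sign[of "int N" p]
  by (simp add: cyclic_letter_def Suc_le_eq nat_less_iff)

lemma cyclic_letter_eq_iff: "cyclic_letter N p = cyclic_letter N q \<longleftrightarrow> p mod int N = q mod int N"
  using N by (simp add: cyclic_letter_def eq_nat_nat_iff)

lemma obtain_cyclic_position:
  assumes "i \<in> {1..N}"
  obtains p where "cyclic_letter N p = i"
proof
  have "(i - 1) mod N = i - 1" "Suc (i - 1) = i" using assms by auto
  then show "cyclic_letter N (int (i - 1)) = i" by (simp only: cyclic_letter_of_nat)
qed

lemma div_jump:
  "(p + 1 - k) div int N - (p - k) div int N
    = of_bool (cyclic_letter N p = cyclic_letter N (k - 1))"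
  using N div_add_one_diff[of "int N" p k] by (simp add: cyclic_letter_eq_iff)

end

context labelling
begin

definition cyclic_path :: "nat \<Rightarrow> int \<Rightarrow> real ^ 'n" where
  "cyclic_path N p = (\<Sum>q\<in>{0..<p}. centered_axis (e (cyclic_letter N q)))
     - (\<Sum>q\<in>{p..<0}. centered_axis (e (cyclic_letter N q)))"

lemma cyclic_path_step:
  "cyclic_path N (p + 1) = cyclic_path N p + centered_axis (e (cyclic_letter N p))"
proof (cases "0 \<le> p")
  case True
  then have "{0..<p + 1} = insert p {0..<p}" by auto
  then show ?thesis using True by (simp add: cyclic_path_def)
next
  case False
  then have "{p..<0} = insert p {p + 1..<0}" by auto
  then show ?thesis using False by (simp add: cyclic_path_def)
qed

lemma cyclic_path_add_nat:
  "cyclic_path N (p + int k)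
    = cyclic_path N p + (\<Sum>j<k. centered_axis (e (cyclic_letter N (p + int j))))"
proof (induction k)
  case (Suc k)
  then show ?case using cyclic_path_step[of N "p + int k"] by (simp add: algebra_simps)
qed simp

lemma cyclic_path_add_period:
  "cyclic_path N (p + int N) = cyclic_path N p + block_vector {1..N}"
proof -
  have "cyclic_path N (q + 1 + int N) - cyclic_path N (q + 1)
      = cyclic_path N (q + int N) - cyclic_path N q" for q
    using cyclic_path_step[of N q] cyclic_path_step[of N "q + int N"]
    by (simp add: cyclic_letter_add_period add.commute add.left_commute)
  then have "cyclic_path N (p + int N) - cyclic_path N p
      = cyclic_path N (0 + int N) - cyclic_path N 0"
    by (rule int_constI)
  also have "\<dots> = block_vector {1..N}"
    using cyclic_path_add_nat[of N 0 N]
    by (simp add: block_vector_def cyclic_letter_of_nat sum.atLeast1_atMost_eq)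
  finally show ?thesis by (simp add: algebra_simps)
qed

lemma inner_cyclic_path_step:
  assumes "u \<in> sum_zero_space"
  shows "u \<bullet> cyclic_path N (p + 1) - u \<bullet> cyclic_path N p = u $ e (cyclic_letter N p)"
  by (simp add: cyclic_path_step inner_add_right inner_centered_axis[OF assms])

lemma type_A_root_nth:
  assumes "i \<in> {1..n}" "j \<in> {1..n}" "k \<in> {1..n}"
  shows "type_A_root (e i) (e j) $ e k = of_bool (k = i) - of_bool (k = j)"
  using assms by (simp add: type_A_root_def axis_def label_eq_iff)

lemma inner_cyclic_path_add_period:
  "v \<bullet> cyclic_path N (p + int N) = v \<bullet> cyclic_path N p + v \<bullet> block_vector {1..N}"
  by (simp add: cyclic_path_add_period inner_add_right)

lemma exists_peak_constant_root_periodic: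
  assumes N: "0 < N" "N \<le> n" and v: "v \<in> sum_zero_space" "v \<bullet> block_vector {1..N} = 0"
    and i: "i \<in> {1..N}" "v $ e i \<noteq> 0"
  obtains a b where "a \<noteq> b"
    "peak_constant (\<lambda>p. v \<bullet> cyclic_path N p) (\<lambda>p. type_A_root a b \<bullet> cyclic_path N p)"
proof -
  let ?letter = "cyclic_letter N" and ?W = "\<lambda>p. v \<bullet> cyclic_path N p"
  have letter: "?letter p \<in> {1..n}" for p using cyclic_letter_in[OF N(1), of p] N(2) by auto
  obtain p where "?letter p = i" using obtain_cyclic_position[OF N(1) i(1)] .
  then have nonconst: "?W (p + 1) \<noteq> ?W p"
    using inner_cyclic_path_step[OF v(1), of N p] i(2) by auto
  have per: "?W (p + int N) = ?W p" for p using v(2) by (simp add: inner_cyclic_path_add_period)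
  obtain k l where kl: "k < l" "l < k + int N"
    and peak: "peak_constant ?W (\<lambda>p. (p - k) div int N - (p - l) div int N)"
    by (rule peak_constant_periodic[of "int N" ?W, OF _ per nonconst]) (use N(1) in simp)
  let ?u = "type_A_root (e (?letter (k - 1))) (e (?letter (l - 1))) :: real ^ 'n"
  have "\<not> int N dvd (l - 1) - (k - 1)" using kl zdvd_imp_le[of "int N" "l - k"] by auto
  then have "?letter (k - 1) \<noteq> ?letter (l - 1)"
    unfolding cyclic_letter_eq_iff[OF N(1)] by (metis mod_eq_dvd_iff)
  then have "e (?letter (k - 1)) \<noteq> e (?letter (l - 1))" using letter label_eq_iff by blast
  moreover have "?u \<bullet> cyclic_path N (p + 1) - ?u \<bullet> cyclic_path N p
      = of_int ((p + 1 - k) div int N - (p + 1 - l) div int N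
        - ((p - k) div int N - (p - l) div int N))" for p
  proof -
    have "(p + 1 - k) div int N - (p + 1 - l) div int N - ((p - k) div int N - (p - l) div int N)
        = of_bool (?letter p = ?letter (k - 1)) - of_bool (?letter p = ?letter (l - 1))"
      using div_jump[OF N(1), of p k] div_jump[OF N(1), of p l] by linarith
    then show ?thesis
      by (simp add: inner_cyclic_path_step type_A_root_in_sum_zero_space
          type_A_root_nth[OF letter letter letter])
  qed
  then have "peak_constant ?W (\<lambda>p. ?u \<bullet> cyclic_path N p)"
    by (rule peak_constant_of_int_diff[OF peak])
  ultimately show ?thesis by (rule that)
qed

lemma exists_peak_constant_root_drift:
  assumes N: "0 < N" "N < n" and v: "v \<bullet> block_vector {1..N} \<noteq> 0"
  obtains a b where "a \<noteq> b"
    "peak_constant (\<lambda>p. v \<bullet> cyclic_path N p) (\<lambda>p. type_A_root a b \<bullet> cyclic_path N p)"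
proof -
  let ?letter = "cyclic_letter N" and ?W = "\<lambda>p. v \<bullet> cyclic_path N p"
  have letter: "?letter p \<in> {1..n}" "?letter p \<noteq> n" for p
    using cyclic_letter_in[OF N(1), of p] N(2) by auto
  have n: "n \<in> {1..n}" using N by simp
  note drift = inner_cyclic_path_add_period[of v N]
  consider (decreasing) "v \<bullet> block_vector {1..N} < 0" | (increasing) "0 < v \<bullet> block_vector {1..N}"
    using v by linarith
  then obtain k where peak: "peak_constant ?W (\<lambda>p. (p - k) div int N)"
  proof cases
    case decreasing
    show ?thesis
      by (rule peak_constant_decreasing[of "int N" ?W, OF _ drift decreasing])
        (use N(1) that in auto)
  next
    case increasing
    show ?thesis
      by (rule peak_constant_increasing[of "int N" ?W, OF _ drift increasing])
        (use N(1) that in auto)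
  qed
  let ?u = "type_A_root (e (?letter (k - 1))) (e n) :: real ^ 'n"
  have "e (?letter (k - 1)) \<noteq> e n" using letter n label_eq_iff by blast
  moreover have "?u \<bullet> cyclic_path N (p + 1) - ?u \<bullet> cyclic_path N p
      = of_int ((p + 1 - k) div int N - (p - k) div int N)" for p
    unfolding div_jump[OF N(1)]
    by (simp add: inner_cyclic_path_step type_A_root_in_sum_zero_space letter(2)
        type_A_root_nth[OF letter(1) n letter(1)])
  then have "peak_constant ?W (\<lambda>p. ?u \<bullet> cyclic_path N p)"
    by (rule peak_constant_of_int_diff[OF peak])
  ultimately show ?thesis by (rule that)
qed

lemma exists_peak_constant_root:
  assumes N: "0 < N" "N \<le> n" "n \<le> Suc N" and v: "v \<in> sum_zero_space" "v \<noteq> 0"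
  obtains a b where "a \<noteq> b"
    "peak_constant (\<lambda>p. v \<bullet> cyclic_path N p) (\<lambda>p. type_A_root a b \<bullet> cyclic_path N p)"
proof -
  have drift: "v \<bullet> block_vector {1..N} = (\<Sum>i=1..N. v $ e i)"
    unfolding block_vector_def inner_sum_right inner_centered_axis[OF v(1)] ..
  have total: "(\<Sum>i=1..n. v $ e i) = 0"
    using v(1) by (simp add: sum_zero_space_def sum_UNIV)
  show ?thesis
  proof (cases "v \<bullet> block_vector {1..N} = 0")
    case True
    obtain a where "v $ a \<noteq> 0" using v(2) by (metis vec_eq_iff zero_index)
    then obtain i where i: "i \<in> {1..n}" "v $ e i \<noteq> 0" using obtain_label by metis
    have "i \<in> {1..N}"
    proof (rule ccontr)
      assume "i \<notin> {1..N}"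
      then have "n = Suc N" "i = n" using i(1) N by auto
      then show False using total True drift i(2) by simp
    qed
    then show ?thesis using exists_peak_constant_root_periodic N(1,2) v(1) True i(2) that by metis
  next
    case False
    then have "N < n" using N(2) total drift by (auto simp: le_less)
    then show ?thesis using exists_peak_constant_root_drift N(1) False that by metis
  qed
qed

definition path_hull :: "nat \<Rightarrow> (real ^ 'n) set \<Rightarrow> bool" where
  "path_hull N D \<longleftrightarrow> (\<exists>c a b. D = (+) c ` (convex hull (cyclic_path N ` {a..b})))"

lemma path_hull_translation:
  assumes "path_hull N D"
  shows "path_hull N ((+) c ` D)"
proof -
  obtain d a b where "D = (+) d ` (convex hull (cyclic_path N ` {a..b}))"
    using assms unfolding path_hull_def by blast
  then have "(+) c ` D = (+) (d + c) ` (convex hull (cyclic_path N ` {a..b}))"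
    by (simp only: translation_assoc)
  then show ?thesis unfolding path_hull_def by blast
qed

lemma path_hull_constant_on_max_face:
  assumes "path_hull N D"
    and peak: "peak_constant (\<lambda>p. v \<bullet> cyclic_path N p) (\<lambda>p. u \<bullet> cyclic_path N p)"
  shows "(\<bullet>) u constant_on max_face v D"
proof -
  obtain c a b where D: "D = (+) c ` (convex hull (cyclic_path N ` {a..b}))"
    using assms(1) unfolding path_hull_def by blast
  let ?V = "cyclic_path N ` {a..b}"
  have "u \<bullet> x = u \<bullet> y" if max: "x \<in> max_face v ?V" "y \<in> max_face v ?V" for x y
  proof -
    obtain p q where x: "x = cyclic_path N p" "p \<in> {a..b}" and y: "y = cyclic_path N q" "q \<in> {a..b}"
      using max by (auto simp: max_face_def)
    show ?thesis
      unfolding x(1) y(1) by (rule peak_constantD[OF peak x(2) y(2)])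
        (use max in \<open>simp_all add: max_face_def x(1) y(1)\<close>)
  qed
  then have "(\<bullet>) u constant_on max_face v ?V" unfolding constant_on_def by metis
  then show ?thesis
    unfolding D
    by (intro constant_on_max_face_translation constant_on_max_face_convex_hull finite_imp_compact)
      simp_all
qed

lemma path_hull_Delta:
  fixes b c :: nat
  assumes "ordered_set_partition n (B # map (\<lambda>i. {i}) (map (\<lambda>j. Suc (j mod N)) [b..<c]))"
    (is "ordered_set_partition n (B # ?T)")
    and "b \<le> c"
  shows "path_hull N (Delta e (B # ?T))"
proof -
  have "vertex ?T k = cyclic_path N (int b + int k) - cyclic_path N (int b)" if "k \<le> c - b" for k
    unfolding vertex_def cyclic_path_add_nat
    using that
    by (auto intro!: sum.cong simp: block_vector_singleton cyclic_letter_of_nat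
        simp flip: of_nat_add)
  then have "vertex ?T ` {..length ?T}
      = (\<lambda>p. cyclic_path N p - cyclic_path N (int b)) ` (\<lambda>k. int b + int k) ` {..c - b}"
    unfolding image_image by (intro image_cong) auto
  also have "(\<lambda>k. int b + int k) ` {..c - b} = int ` {b..c}"
    using \<open>b \<le> c\<close> image_add_atLeastAtMost[of b 0 "c - b"]
    by (simp add: atMost_atLeast0 flip: image_image of_nat_add)
  also have "\<dots> = {int b..int c}" by (rule image_int_atLeastAtMost)
  finally have "vertex ?T ` {..length ?T}
      = (+) (- cyclic_path N (int b)) ` cyclic_path N ` {int b..int c}"
    by (simp add: image_image)
  then have "Delta e (B # ?T)
      = (+) (- cyclic_path N (int b) + block_vector B)
        ` (convex hull (cyclic_path N ` {int b..int c}))"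
    by (simp only: Delta_eq_convex_hull[OF assms(1)] vertices_Cons[OF assms(1)]
        convex_hull_translation translation_assoc)
  then show ?thesis unfolding path_hull_def by blast
qed

lemma block_vector_all: "block_vector {1..n} = 0"
proof (rule eq_0_if_constant_coordinates[OF block_vector_in_sum_zero_space])
  fix a
  obtain i where "i \<in> {1..n}" "a = e i" by (rule obtain_label)
  then show "block_vector {1..n} $ a = 0" using n_pos by (simp add: block_vector_nth)
qed

lemma span_eq_sum_zero_spaceI:
  fixes A :: "(real ^ 'n) set"
  assumes "A \<subseteq> sum_zero_space" "\<And>i. i \<in> {1..<n} \<Longrightarrow> centered_axis (e i) \<in> span A"
  shows "span A = sum_zero_space"
proof
  show "span A \<subseteq> sum_zero_space" using assms(1) subspace_sum_zero_space by (rule span_minimal)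
  have "{1..n} = insert n {1..<n}" using n_pos by auto
  then have "centered_axis (e n) + block_vector {1..<n} = 0"
    using block_vector_all by (simp add: block_vector_def)
  then have "centered_axis (e n) = - block_vector {1..<n}"
    by (simp add: eq_neg_iff_add_eq_0)
  moreover have "block_vector {1..<n} \<in> span A"
    unfolding block_vector_def using assms(2) by (rule span_sum)
  ultimately have "centered_axis (e n) \<in> span A" by (simp add: span_neg)
  then have axis: "centered_axis a \<in> span A" for a
    using obtain_label[of a] assms(2) by (metis atLeastAtMost_iff atLeastLessThan_iff le_less)
  show "sum_zero_space \<subseteq> span A"
  proof
    fix x :: "real ^ 'n" assume "x \<in> sum_zero_space"
    then have x: "x = (\<Sum>a\<in>UNIV. x $ a *\<^sub>R centered_axis a)" by (rule sum_zero_space_expansion)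
    show "x \<in> span A" by (subst x) (intro span_sum span_scale axis)
  qed
qed

lemma alcoved_sum_path_hulls:
  assumes I: "finite I" and S: "\<And>i. i \<in> I \<Longrightarrow> ordered_set_partition n (S i)"
    and N: "0 < N" "N \<le> n" "n \<le> Suc N"
    and hull: "\<And>i. i \<in> I \<Longrightarrow> path_hull N (Delta e (S i))"
    and singleton: "\<And>j. j \<in> {1..<n} \<Longrightarrow> \<exists>i\<in>I. {j} \<in> set (S i)"
  shows "alcoved (\<Sum>i\<in>I. Delta e (S i))"
proof (rule alcoved_sumI[OF I])
  show "polytope (Delta e (S i))" if "i \<in> I" for i by (rule polytope_Delta[OF S[OF that]])
  show "0 \<in> Delta e (S i)" if "i \<in> I" for i by (rule zero_in_Delta)
  show "span (\<Union>i\<in>I. Delta e (S i)) = sum_zero_space"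
  proof (rule span_eq_sum_zero_spaceI)
    show "(\<Union>i\<in>I. Delta e (S i)) \<subseteq> sum_zero_space" by (auto simp: Delta_def)
    fix j assume "j \<in> {1..<n}"
    then obtain i where i: "i \<in> I" "{j} \<in> set (S i)" using singleton by blast
    then have "centered_axis (e j) \<in> span (Delta e (S i))"
      using block_vector_in_span_Delta[OF S[OF i(1)] i(2)] by (simp add: block_vector_singleton)
    then show "centered_axis (e j) \<in> span (\<Union>i\<in>I. Delta e (S i))"
      using i(1) span_mono[of "Delta e (S i)" "\<Union>i\<in>I. Delta e (S i)"] by blast
  qed
  fix v :: "real ^ 'n" assume "v \<in> sum_zero_space" "v \<noteq> 0"
  then obtain a b where "a \<noteq> b"
    and "peak_constant (\<lambda>p. v \<bullet> cyclic_path N p) (\<lambda>p. type_A_root a b \<bullet> cyclic_path N p)"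
    using exists_peak_constant_root[OF N] by blast
  then show "\<exists>a b. a \<noteq> b \<and> (\<forall>i\<in>I. (\<bullet>) (type_A_root a b) constant_on max_face v (Delta e (S i)))"
    using path_hull_constant_on_max_face hull by blast
qed

end

section \<open>Cyclohedron, associahedron and the D-hat polytope\<close>

lemma rotate_upt_conv_map: "rotate r [1..<Suc n] = map (\<lambda>j. Suc (j mod n)) [r..<r + n]"
  by (intro nth_equalityI) (auto simp: nth_rotate simp del: upt_Suc)

lemma cyclic_rest_conv_map:
  assumes "s \<in> {1..m}" "t \<in> {1..m}"
  shows "cyclic_rest m s t = map (\<lambda>j. Suc (j mod m)) [(if s \<le> t then t else t + m)..<s - 1 + m]"
  using assms
  by (intro nth_equalityI)
    (auto simp: cyclic_rest_def nth_append le_mod_geq not_less simp del: upt_Suc)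

lemma filter_length_le_1_split:
  assumes "length (filter P xs) \<le> 1" "xs \<noteq> []"
  obtains as b cs where "xs = as @ b # cs" "\<And>x. x \<in> set (as @ cs) \<Longrightarrow> \<not> P x"
proof (cases "\<exists>x\<in>set xs. P x")
  case True
  then obtain as b cs where xs: "xs = as @ b # cs" "P b" by (metis split_list)
  then have "filter P as = []" "filter P cs = []" using assms(1) by auto
  then have "\<And>x. x \<in> set (as @ cs) \<Longrightarrow> \<not> P x" by (auto simp: filter_empty_conv)
  with xs(1) show ?thesis by (rule that)
next
  case False
  obtain b cs where "xs = b # cs" using assms(2) by (cases xs) auto
  then show ?thesis using that[of "[]" b cs] False by auto
qed

lemma map_singleton_concat:
  assumes "\<And>xs. xs \<in> set xss \<Longrightarrow> length xs = 1"
  shows "map (\<lambda>x. [x]) (concat xss) = xss"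
  using assms by (induction xss) (fastforce simp: length_Suc_conv)+

lemma one_big_coarsening_rotate:
  assumes S: "S \<in> one_big_coarsenings n" and "0 < n"
  obtains k r ys zs where "rotate k S = set ys # map (\<lambda>i. {i}) zs" "ys @ zs = rotate r [1..<Suc n]"
proof -
  obtain xss r where Sx: "S = map set xss" and ne: "[] \<notin> set xss"
    and conc: "concat xss = rotate r [1..<Suc n]"
    and big: "length (filter (\<lambda>B. card B > 1) S) \<le> 1"
    using S unfolding one_big_coarsenings_def cyclic_coarsenings_def by blast
  have "length (filter (\<lambda>xs. card (set xs) > 1) xss) \<le> 1"
    using big by (simp add: Sx filter_map comp_def)
  moreover have "length (concat xss) = n" unfolding conc by (simp del: upt_Suc)
  then have "xss \<noteq> []" using \<open>0 < n\<close> by auto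
  ultimately obtain as ys cs where xss: "xss = as @ ys # cs"
    and small: "\<And>xs. xs \<in> set (as @ cs) \<Longrightarrow> \<not> card (set xs) > 1"
    using filter_length_le_1_split by metis
  define zs where "zs = concat (cs @ as)"
  have "distinct (concat xss)" unfolding conc by simp
  then have "length xs = 1" if xs: "xs \<in> set (cs @ as)" for xs
  proof -
    have "xs \<in> set xss" using xs by (auto simp: xss)
    then have "distinct xs" "xs \<noteq> []"
      using \<open>distinct (concat xss)\<close> ne by (auto simp: distinct_concat_iff)
    moreover have "\<not> length xs > 1"
      using small[of xs] xs \<open>distinct xs\<close> by (auto simp: distinct_card)
    ultimately show ?thesis by (cases xs) auto
  qed
  then have "cs @ as = map (\<lambda>i. [i]) zs" unfolding zs_def by (rule map_singleton_concat[symmetric])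
  then have "map set (cs @ as) = map (\<lambda>i. {i}) zs" by simp
  moreover have "rotate (length as) S = map set (ys # cs @ as)"
    unfolding Sx xss rotate_map using rotate_append[of as "ys # cs"] by simp
  ultimately have "rotate (length as) S = set ys # map (\<lambda>i. {i}) zs" by simp
  moreover have "ys @ zs = rotate (length (concat as)) (concat xss)"
    using rotate_append[of "concat as" "concat (ys # cs)"] by (simp add: xss zs_def)
  then have "ys @ zs = rotate (length (concat as) + r) [1..<Suc n]"
    by (simp only: conc rotate_rotate)
  ultimately show ?thesis by (rule that)
qed

context labelling
begin

lemma path_hull_one_big_coarsening:
  assumes S: "S \<in> one_big_coarsenings n"
  shows "path_hull n (Delta e S)"
proof -
  obtain k r ys zs where rot: "rotate k S = set ys # map (\<lambda>i. {i}) zs"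
    and yz: "ys @ zs = rotate r [1..<Suc n]"
    using one_big_coarsening_rotate[OF S n_pos] .
  have osp: "ordered_set_partition n S"
    using S ordered_set_partition_cyclic_coarsening by (simp add: one_big_coarsenings_def)
  have "length ys \<le> n" using arg_cong[OF yz, of length] by (simp del: upt_Suc)
  have "zs = drop (length ys) (ys @ zs)" by simp
  also have "\<dots> = map (\<lambda>j. Suc (j mod n)) [r + length ys..<r + n]"
    unfolding yz rotate_upt_conv_map by (simp add: drop_map)
  finally have "path_hull n (Delta e (rotate k S))"
    using path_hull_Delta[of "set ys" n "r + length ys" "r + n"] \<open>length ys \<le> n\<close>
      ordered_set_partition_rotate[OF osp, of k]
    by (simp add: rot)
  moreover obtain c where "Delta e S = (+) c ` Delta e (rotate k S)"
    using Delta_rotate[OF osp] by blast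
  ultimately show ?thesis by (simp add: path_hull_translation)
qed

lemma path_hull_S_hat:
  assumes "s \<in> {1..n - 1}" "t \<in> {1..n - 1}"
  shows "path_hull (n - 1) (Delta e (S_hat n s t))"
  using path_hull_Delta[OF ordered_set_partition_S_hat[OF assms, unfolded S_hat_def
        cyclic_rest_conv_map[OF assms]]] assms
  unfolding S_hat_def cyclic_rest_conv_map[OF assms] by auto

lemma alcoved_sum_one_big_coarsenings:
  assumes R: "shift_representatives C R" "C \<subseteq> one_big_coarsenings n"
    and C: "map (\<lambda>i. {i}) [1..<Suc n] \<in> C"
  shows "alcoved (\<Sum>S\<in>R. Delta e S)"
proof (rule alcoved_sum_path_hulls[where N = n])
  have RC: "R \<subseteq> one_big_coarsenings n" using R by (auto simp: shift_representatives_def)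
  then have cyc: "R \<subseteq> cyclic_coarsenings n" by (auto simp: one_big_coarsenings_def)
  then show "finite R" using finite_cyclic_coarsenings finite_subset by blast
  show "ordered_set_partition n S" if "S \<in> R" for S
    using that cyc ordered_set_partition_cyclic_coarsening by blast
  show "path_hull n (Delta e S)" if "S \<in> R" for S
    using that RC path_hull_one_big_coarsening by blast
  obtain k where "rotate k (map (\<lambda>i. {i}) [1..<Suc n]) \<in> R"
    using R(1) C unfolding shift_representatives_def by blast
  moreover have "{j} \<in> set (rotate k (map (\<lambda>i. {i}) [1..<Suc n]))" if "j \<in> {1..<n}" for j
    using that by auto
  ultimately show "\<exists>S\<in>R. {j} \<in> set S" if "j \<in> {1..<n}" for j using that by blast
qed (use n_pos in auto)

lemma alcoved_D_hat:
  assumes "n \<ge> 3"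
  shows "alcoved (D_hat e n)"
  unfolding D_hat_def case_prod_beta'
proof (rule alcoved_sum_path_hulls[where N = "n - 1"])
  fix j assume j: "j \<in> {1..<n}"
  define s where "s = (if j = 1 then 2 else 1 :: nat)"
  have s: "s \<in> {1..n - 1}" "s \<noteq> j" using assms by (auto simp: s_def)
  then have "j \<in> set (cyclic_rest (n - 1) s s)" using j by (auto simp: cyclic_rest_def)
  then have "{j} \<in> set (S_hat n s s)" by (simp add: S_hat_def)
  then show "\<exists>p\<in>{1..n - 1} \<times> {1..n - 1}. {j} \<in> set (S_hat n (fst p) (snd p))"
    using s(1) by (intro bexI[of _ "(s, s)"]) auto
qed (use assms ordered_set_partition_S_hat path_hull_S_hat in auto)

end

lemma singletons_in_one_big_coarsenings_last:
  "map (\<lambda>i. {i}) [1..<Suc n] \<in> one_big_coarsenings_last n"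
proof -
  let ?xss = "map (\<lambda>i. [i]) [1..<Suc n]"
  have "concat (map (\<lambda>i. [i]) xs) = xs" for xs :: "nat list" by (induction xs) auto
  then have "concat ?xss = rotate 0 [1..<Suc n]" by simp
  moreover have "map (\<lambda>i. {i}) [1..<Suc n] = map set ?xss" by simp
  moreover have "[] \<notin> set ?xss" by auto
  ultimately have "map (\<lambda>i. {i}) [1..<Suc n] \<in> cyclic_coarsenings n"
    unfolding cyclic_coarsenings_def by blast
  then show ?thesis
    by (auto simp: one_big_coarsenings_last_def one_big_coarsenings_def filter_map comp_def
        simp del: upt_Suc)
qed

theorem theorem6p5:
  fixes e :: "nat \<Rightarrow> 'n::finite" and n :: nat
  assumes "n = CARD('n)"
    and "bij_betw e {1..n} (UNIV :: 'n set)"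
  shows "(n \<ge> 2 \<longrightarrow>
            (\<forall>R. shift_representatives (one_big_coarsenings n) R \<longrightarrow>
               alcoved (\<Sum>S\<in>R. Delta e S))) \<and>
         (\<forall>R. shift_representatives (one_big_coarsenings_last n) R \<longrightarrow>
               alcoved (\<Sum>S\<in>R. Delta e S)) \<and>
         (n \<ge> 3 \<longrightarrow> alcoved (D_hat e n))"
proof -
  interpret labelling e n using assms by unfold_locales
  have last: "one_big_coarsenings_last n \<subseteq> one_big_coarsenings n"
    by (auto simp: one_big_coarsenings_last_def)
  have singletons: "map (\<lambda>i. {i}) [1..<Suc n] \<in> one_big_coarsenings_last n"
    by (rule singletons_in_one_big_coarsenings_last)
  show ?thesis
    using alcoved_sum_one_big_coarsenings[OF _ order.refl]
      alcoved_sum_one_big_coarsenings[OF _ last] singletons last alcoved_D_hat by blast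
qed

end
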